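(* Let $(X,\wp)$ be a consistency space in which every element has a negation, and let $x,y\in X$. Then $\{x\}\sim\{y\}$ if and only if $x\to y$ and $y\to x$.
   Context: A consistency space $(X,\wp)$ consists of a nonempty set $X$ and a nonempty collection $\wp$ of subsets of $X$ such that (1) $X\notin\wp$, and (2) if $A\in\wp$ and $B\subseteq A$, then $B\in\wp$. For $A,B\subseteq X$, write $A\sim B$ if for every $C\subseteq X$, $A\cup C\in\wp$ if and only if $B\cup C\in\wp$. A negation of $x\in X$ is any element $\bar{x}\in X$ satisfying: (1) $\{x,\bar{x}\}\notin\wp$; (2) for all $z\in X$, if $\{x,z\}\notin\wp$ then $\{\bar{x},z\}\sim\{z\}$; (3) for all $z\in X$, if $\{\bar{x},z\}\notin\wp$ then $\{x,z\}\sim\{z\}$. For each $x\in X$, $\bar{x}$ denotes an (arbitrary but fixed) negation of $x$. For $x,y\in X$, write $x\to y$ if and only if $\{x,\bar{y}\}\notin\wp$. *)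

theory Defs
  imports Main
begin

locale consistency_space =
  fixes X :: "'a set" and P :: "'a set set"
  assumes carrier_nonempty: "X \<noteq> {}"
    and family_nonempty: "P \<noteq> {}"
    and family_subset: "P \<subseteq> Pow X"
    and carrier_inconsistent: "X \<notin> P"
    and down_closed: "A \<in> P \<Longrightarrow> B \<subseteq> A \<Longrightarrow> B \<in> P"

definition cons_equiv :: "'a set \<Rightarrow> 'a set set \<Rightarrow> 'a set \<Rightarrow> 'a set \<Rightarrow> bool" where
  "cons_equiv X P A B \<longleftrightarrow> (\<forall>C\<subseteq>X. A \<union> C \<in> P \<longleftrightarrow> B \<union> C \<in> P)"

definition is_negation :: "'a set \<Rightarrow> 'a set set \<Rightarrow> 'a \<Rightarrow> 'a \<Rightarrow> bool" where
  "is_negation X P x x' \<longleftrightarrow>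
     x' \<in> X \<and>
     {x, x'} \<notin> P \<and>
     (\<forall>z\<in>X. {x, z} \<notin> P \<longrightarrow> cons_equiv X P {x', z} {z}) \<and>
     (\<forall>z\<in>X. {x', z} \<notin> P \<longrightarrow> cons_equiv X P {x, z} {z})"

text \<open>
  The relation depends on a choice \<open>neg\<close> of one negation for each element of the carrier.
  That \<open>neg x\<close> really is a negation of \<open>x\<close> is a separate hypothesis wherever this is used.
\<close>

definition cons_imp :: "'a set set \<Rightarrow> ('a \<Rightarrow> 'a) \<Rightarrow> 'a \<Rightarrow> 'a \<Rightarrow> bool" where
  "cons_imp P neg x y \<longleftrightarrow> {x, neg y} \<notin> P"

end

theory Submission
  imports Defs
begin

text \<open>
  The negation of \<open>y\<close> turns implication into absorption: if \<open>x \<rightarrow> y\<close>, that is, if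
  \<open>x\<close> clashes with the negation of \<open>y\<close>, then the third negation axiom says that adding
  \<open>y\<close> to \<open>{x}\<close> does not change which sets are consistent with it. When the implication
  goes both ways, \<open>{x}\<close> and \<open>{y}\<close> are therefore both equivalent to \<open>{x, y}\<close>, hence to
  each other. Conversely, elements with equivalent singletons clash with the same
  elements, and \<open>y\<close> clashes with its own negation, so \<open>x\<close> does too.
\<close>

lemma cons_equiv_sym: "cons_equiv X P A B \<Longrightarrow> cons_equiv X P B A"
  by (simp add: cons_equiv_def)

lemma cons_equiv_trans:
  "cons_equiv X P A B \<Longrightarrow> cons_equiv X P B C \<Longrightarrow> cons_equiv X P A C"
  by (simp add: cons_equiv_def)

lemma cons_imp_absorb:
  assumes "is_negation X P y (neg y)" and "x \<in> X" and "cons_imp P neg x y"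
  shows "cons_equiv X P {x, y} {x}"
  using assms by (simp add: is_negation_def cons_imp_def insert_commute)

text \<open>
  Equivalence is tested against the single set \<open>{neg y}\<close>, which is inconsistent with \<open>y\<close>.
\<close>

lemma cons_equiv_imp:
  assumes "is_negation X P y (neg y)" and "cons_equiv X P {x} {y}"
  shows "cons_imp P neg x y"
proof -
  have "neg y \<in> X" and "{y} \<union> {neg y} \<notin> P"
    using assms(1) by (simp_all add: is_negation_def insert_commute)
  then have "{x} \<union> {neg y} \<notin> P"
    using assms(2) unfolding cons_equiv_def by blast
  then show ?thesis
    by (simp add: cons_imp_def insert_commute)
qed

theorem proposition9:
  fixes X :: "'a set" and P :: "'a set set" and neg :: "'a \<Rightarrow> 'a" and x y :: 'a
  assumes "consistency_space X P"
    and "\<forall>z\<in>X. is_negation X P z (neg z)"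
    and "x \<in> X" and "y \<in> X"
  shows "cons_equiv X P {x} {y} \<longleftrightarrow> cons_imp P neg x y \<and> cons_imp P neg y x"
proof
  have nx: "is_negation X P x (neg x)" and ny: "is_negation X P y (neg y)"
    using assms(2-4) by auto
  {
    assume "cons_equiv X P {x} {y}"
    then show "cons_imp P neg x y \<and> cons_imp P neg y x"
      using cons_equiv_imp[where neg = neg] nx ny cons_equiv_sym by metis
  next
    assume imp: "cons_imp P neg x y \<and> cons_imp P neg y x"
    have "cons_equiv X P {x, y} {x}"
      using ny assms(3) imp cons_imp_absorb by metis
    moreover have "cons_equiv X P {x, y} {y}"
      using nx assms(4) imp cons_imp_absorb insert_commute by metis
    ultimately show "cons_equiv X P {x} {y}"
      using cons_equiv_sym cons_equiv_trans by metis
  }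
qed

end
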